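(* Let $J$ be an almost complex structure on a real $3$-Bihom-Lie algebra $(L,[\cdot,\cdot,\cdot],\alpha,\beta)$. If $$[x,y,z]=[x,Jy,Jz]+[Jx,y,Jz]+[Jx,Jy,z]\quad\text{for all }x,y,z\in L,$$ then $J$ is a complex structure on $L$.
   Context: A real $3$-Bihom-Lie algebra is a $4$-tuple $(L,[\cdot,\cdot,\cdot],\alpha,\beta)$ consisting of a real vector space $L$, a $3$-linear map $[\cdot,\cdot,\cdot]\colon L\times L\times L\to L$ and two linear maps $\alpha,\beta\colon L\to L$ such that for all $x,y,z,u,v\in L$: (1) $\alpha\beta=\beta\alpha$; (2) $\alpha([x,y,z])=[\alpha(x),\alpha(y),\alpha(z)]$ and $\beta([x,y,z])=[\beta(x),\beta(y),\beta(z)]$; (3) $[\beta(x),\beta(y),\alpha(z)]=-[\beta(y),\beta(x),\alpha(z)]=-[\beta(x),\beta(z),\alpha(y)]$; (4) $[\beta^2(u),\beta^2(v),[\beta(x),\beta(y),\alpha(z)]]=[\beta^2(y),\beta^2(z),[\beta(u),\beta(v),\alpha(x)]]-[\beta^2(x),\beta^2(z),[\beta(u),\beta(v),\alpha(y)]]+[\beta^2(x),\beta^2(y),[\beta(u),\beta(v),\alpha(z)]]$. An almost complex structure on $L$ is a linear map $J\colon L\to L$ with $J^2=-\mathrm{Id}$, $J\alpha=\alpha J$ and $J\beta=\beta J$. It is a complex structure if for all $x,y,z\in L$, $$J[x,y,z]=-[Jx,Jy,Jz]+[Jx,y,z]+[x,Jy,z]+[x,y,Jz]+J[Jx,Jy,z]+J[x,Jy,Jz]+J[Jx,y,Jz].$$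 *)

theory Defs
  imports Complex_Main
begin

definition trilinear :: "('a::real_vector \<Rightarrow> 'a \<Rightarrow> 'a \<Rightarrow> 'a) \<Rightarrow> bool" where
  "trilinear br \<longleftrightarrow>
     (\<forall>y z. linear (\<lambda>x. br x y z)) \<and>
     (\<forall>x z. linear (\<lambda>y. br x y z)) \<and>
     (\<forall>x y. linear (\<lambda>z. br x y z))"

text \<open>The underlying vector space is the whole type, and \<open>br x y z\<close> is the bracket \<open>[x, y, z]\<close>.\<close>

locale three_bihom_lie_algebra =
  fixes br :: "'a::real_vector \<Rightarrow> 'a \<Rightarrow> 'a \<Rightarrow> 'a"
    and \<alpha> \<beta> :: "'a \<Rightarrow> 'a"
  assumes trilinear_br: "trilinear br"
    and linear_\<alpha>: "linear \<alpha>"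
    and linear_\<beta>: "linear \<beta>"
    and commute: "\<alpha> (\<beta> x) = \<beta> (\<alpha> x)"
    and \<alpha>_br: "\<alpha> (br x y z) = br (\<alpha> x) (\<alpha> y) (\<alpha> z)"
    and \<beta>_br: "\<beta> (br x y z) = br (\<beta> x) (\<beta> y) (\<beta> z)"
    and skew_12: "br (\<beta> x) (\<beta> y) (\<alpha> z) = - br (\<beta> y) (\<beta> x) (\<alpha> z)"
    and skew_23: "br (\<beta> x) (\<beta> y) (\<alpha> z) = - br (\<beta> x) (\<beta> z) (\<alpha> y)"
    and bihom_jacobi:
      "br (\<beta> (\<beta> u)) (\<beta> (\<beta> v)) (br (\<beta> x) (\<beta> y) (\<alpha> z)) =
         br (\<beta> (\<beta> y)) (\<beta> (\<beta> z)) (br (\<beta> u) (\<beta> v) (\<alpha> x))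
       - br (\<beta> (\<beta> x)) (\<beta> (\<beta> z)) (br (\<beta> u) (\<beta> v) (\<alpha> y))
       + br (\<beta> (\<beta> x)) (\<beta> (\<beta> y)) (br (\<beta> u) (\<beta> v) (\<alpha> z))"

definition almost_complex_structure ::
    "('a::real_vector \<Rightarrow> 'a) \<Rightarrow> ('a \<Rightarrow> 'a) \<Rightarrow> ('a \<Rightarrow> 'a) \<Rightarrow> bool" where
  "almost_complex_structure \<alpha> \<beta> J \<longleftrightarrow>
     linear J \<and> (\<forall>x. J (J x) = - x) \<and>
     (\<forall>x. J (\<alpha> x) = \<alpha> (J x)) \<and> (\<forall>x. J (\<beta> x) = \<beta> (J x))"

definition complex_structure ::
    "('a::real_vector \<Rightarrow> 'a \<Rightarrow> 'a \<Rightarrow> 'a) \<Rightarrow> ('a \<Rightarrow> 'a) \<Rightarrow> ('a \<Rightarrow> 'a) \<Rightarrow> ('a \<Rightarrow> 'a) \<Rightarrow> bool" where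
  "complex_structure br \<alpha> \<beta> J \<longleftrightarrow>
     almost_complex_structure \<alpha> \<beta> J \<and>
     (\<forall>x y z. J (br x y z) =
        - br (J x) (J y) (J z)
        + br (J x) y z + br x (J y) z + br x y (J z)
        + J (br (J x) (J y) z) + J (br x (J y) (J z)) + J (br (J x) y (J z)))"

end

theory Submission
  imports Defs
begin

text \<open>The integrability identity splits into two halves that hold separately. Applying
  \<open>J\<close> to the hypothesis equates \<open>J (br x y z)\<close> with the three terms that
  have \<open>J\<close> outside a bracket. Evaluating the hypothesis at \<open>J x\<close>,
  \<open>J y\<close>, \<open>J z\<close> shows that the four remaining terms sum to zero.\<close>

theorem proposition4p11:
  fixes br :: "'a::real_vector \<Rightarrow> 'a \<Rightarrow> 'a \<Rightarrow> 'a"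
    and \<alpha> \<beta> J :: "'a \<Rightarrow> 'a"
  assumes "three_bihom_lie_algebra br \<alpha> \<beta>"
    and "almost_complex_structure \<alpha> \<beta> J"
    and "\<And>x y z. br x y z = br x (J y) (J z) + br (J x) y (J z) + br (J x) (J y) z"
  shows "complex_structure br \<alpha> \<beta> J"
proof -
  interpret three_bihom_lie_algebra br \<alpha> \<beta> by fact
  have lin1: "linear (\<lambda>x. br x y z)" and lin2: "linear (\<lambda>y. br x y z)"
    and lin3: "linear (\<lambda>z. br x y z)" for x y z
    using trilinear_br by (simp_all add: trilinear_def)
  have neg: "br (- x) y z = - br x y z" "br x (- y) z = - br x y z" "br x y (- z) = - br x y z" for x y z
    using linear_neg[OF lin1] linear_neg[OF lin2] linear_neg[OF lin3] by simp_all
  have linear_J: "linear J" and J_J: "J (J x) = - x" for x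
    using assms(2) by (simp_all add: almost_complex_structure_def)
  \<comment> \<open>Each summand of the instance contains \<open>J\<close> squared in exactly two
    slots, so the two minus signs cancel by trilinearity.\<close>
  have br_J: "br (J x) (J y) (J z) = br (J x) y z + br x (J y) z + br x y (J z)" for x y z
    using assms(3)[of "J x" "J y" "J z"] by (simp add: J_J neg)
  have J_br: "J (br x y z) = J (br (J x) (J y) z) + J (br x (J y) (J z)) + J (br (J x) y (J z))" for x y z
    using arg_cong[OF assms(3)[of x y z], of J] by (simp add: linear_add[OF linear_J] ac_simps)
  have "J (br x y z) = - br (J x) (J y) (J z) + br (J x) y z + br x (J y) z + br x y (J z)
      + J (br (J x) (J y) z) + J (br x (J y) (J z)) + J (br (J x) y (J z))" for x y z
    \<comment> \<open>\<open>J_br\<close> is applied just once: its right side contains instances of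
      its left side, so as a simp rule it would loop.\<close>
    by (subst J_br) (simp add: br_J)
  with assms(2) show ?thesis
    unfolding complex_structure_def by blast
qed

end
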